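(* Every finite abelian group is D-sequenceable.
   Context: All groups are finite; $1_G$ denotes the identity of a group $G$. For a sequence ${\bf g}: g_0,\ldots,g_m$ in a group $G$ with $g_0=1_G$, the sequence of consecutive quotients ${\bf \bar g}:\bar g_0,\ldots,\bar g_m$ is defined by $\bar g_0=1_G$ and $\bar g_i=g_{i-1}^{-1}g_i$ for $1\le i\le m$. A finite group $G$ of order $n$ is D-sequenceable (doubly sequenceable) if there is a sequence ${\bf g}: g_0,\ldots,g_{2n-1}$ in $G$ with $g_0=1_G$ such that every element of $G$ appears exactly twice in each of ${\bf g}$ and ${\bf \bar g}$. *)

theory Defs
  imports "HOL-Algebra.Coset"
begin

text \<open>
  A sequence of length \<open>k\<close> is a function on \<open>nat\<close> of which only
  the values at the indices below \<open>k\<close> matter.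
\<close>

definition quotient_seq :: "('a, 'b) monoid_scheme \<Rightarrow> (nat \<Rightarrow> 'a) \<Rightarrow> nat \<Rightarrow> 'a" where
  "quotient_seq G g i =
     (if i = 0 then \<one>\<^bsub>G\<^esub> else inv\<^bsub>G\<^esub> (g (i - 1)) \<otimes>\<^bsub>G\<^esub> g i)"

text \<open>
  Intended for finite groups; \<open>order\<close> is \<open>0\<close> on an infinite carrier,
  and the predicate is then false.
\<close>

definition D_sequenceable :: "('a, 'b) monoid_scheme \<Rightarrow> bool" where
  "D_sequenceable G \<longleftrightarrow>
     (\<exists>g :: nat \<Rightarrow> 'a.
        (\<forall>i < 2 * order G. g i \<in> carrier G) \<and>
        g 0 = \<one>\<^bsub>G\<^esub> \<and>
        (\<forall>x \<in> carrier G. card {i. i < 2 * order G \<and> g i = x} = 2) \<and>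
        (\<forall>x \<in> carrier G. card {i. i < 2 * order G \<and> quotient_seq G g i = x} = 2))"

end

theory Submission
  imports Defs "HOL-Algebra.Multiplicative_Group"
    "HOL-Computational_Algebra.Primes" "Graph_Theory.Euler"
begin

text \<open>
  Replace the sequence by a graph. Let the elements of the group \<open>G\<close> be vertices, and read two
  consecutive entries \<open>x\<close>, \<open>y\<close> as an arc with step \<open>x\<inverse> y\<close>. A doubly sequenced group is then an
  Eulerian circuit in a digraph in which every vertex has in-degree and out-degree two and every
  element is the step of exactly two arcs: the circuit passes through each vertex twice, and
  starting it at a loop (the step \<open>\<one>\<close> must occur) accounts for the entry \<open>\<one>\<close> at index 0 of the
  quotient sequence. By Euler's theorem it is enough to find such a digraph that is connected;
  no ordering of the arcs has to be invented (\<open>D_sequenceable_if_D_digraph\<close>).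

  For a finite abelian group the digraph is found by induction on the order.

  The reduction (\<open>D_digraph_lift\<close>): given a digraph on a quotient \<open>G / H\<close>, replace every vertex by
  its coset of \<open>H\<close> and every arc by a bijection between cosets, a translate of a fixed permutation
  \<open>t\<close> of \<open>H\<close>. If \<open>h \<mapsto> h\<inverse> t h\<close> is a permutation too, all degrees and all multiplicities of steps stay
  equal to two. The digraph on the quotient has two loops; twisting the bijection on one of them by an
  element \<open>c\<close> keeps the new digraph connected as soon as \<open>t\<close> and translation by \<open>c\<close> together connect
  \<open>H\<close>. Such \<open>t\<close> and \<open>c\<close> exist when \<open>H\<close> is cyclic of odd order (inversion, and a generator) and
  when \<open>H\<close> is a Klein four-group (a permutation of order three, and an involution).

  The base case (\<open>D_digraph_squaring\<close>): if \<open>G\<close> contains no such \<open>H\<close> other than the trivial subgroup,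
  it is a 2-group with at most one involution. Then the arcs \<open>x \<rightarrow> x\<^sup>2\<close> and \<open>x \<rightarrow> x\<^sup>2 c\<close> work, where
  \<open>c\<close> is not a square unless \<open>G\<close> is trivial. Written additively these are the arcs \<open>x \<rightarrow> 2x\<close> and
  \<open>x \<rightarrow> 2x + c\<close> of a de Bruijn graph, whose steps are \<open>x\<close> and \<open>x + c\<close>.
\<close>

section \<open>From digraphs to sequences\<close>

text \<open>
  The arcs are the pairs \<open>(x, b)\<close>, running from \<open>x\<close> to \<open>f (x, b)\<close>, so out-degree two is built in and
  parallel arcs and loops are allowed. The last clause is weak connectedness, in the form in which it
  is both proved and used below: a property that does not change along arcs is constant.
\<close>

definition D_digraph :: "('a, 'b) monoid_scheme \<Rightarrow> ('a \<times> bool \<Rightarrow> 'a) \<Rightarrow> bool" where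
  "D_digraph G f \<longleftrightarrow>
     f \<in> carrier G \<times> UNIV \<rightarrow> carrier G \<and>
     (\<forall>y\<in>carrier G. card {e \<in> carrier G \<times> UNIV. f e = y} = 2) \<and>
     (\<forall>d\<in>carrier G. card {e \<in> carrier G \<times> UNIV. inv\<^bsub>G\<^esub> (fst e) \<otimes>\<^bsub>G\<^esub> f e = d} = 2) \<and>
     (\<forall>P. (\<forall>e \<in> carrier G \<times> UNIV. P (fst e) \<longleftrightarrow> P (f e)) \<longrightarrow>
          (\<forall>x\<in>carrier G. \<forall>y\<in>carrier G. P x \<longrightarrow> P y))"

lemma (in pre_digraph) cas_nth:
  assumes "cas u p v" "Suc i < length p"
  shows "head G (p ! i) = tail G (p ! Suc i)"
  using assms
proof (induction p arbitrary: u i)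
  case (Cons e es)
  then show ?case by (cases i; cases es) auto
qed simp

lemma (in pre_digraph) cas_hd_last:
  assumes "cas u p v" "p \<noteq> []"
  shows "tail G (hd p) = u" "head G (last p) = v"
  using assms by (induction p arbitrary: u) (auto split: if_splits)

text \<open>Euler's theorem, with the circuit as a list of arcs read cyclically.\<close>

lemma (in group) D_digraph_euler_tour:
  assumes D: "D_digraph G f" and fin: "finite (carrier G)"
  obtains p where "distinct p" "set p = carrier G \<times> UNIV"
    "\<And>i. i < length p \<Longrightarrow> f (p ! i) = fst (p ! (Suc i mod length p))"
proof -
  define A where "A = carrier G \<times> (UNIV :: bool set)"
  define W where "W = \<lparr>verts = carrier G, arcs = A, tail = fst, head = f\<rparr>"
  have W: "verts W = carrier G" "arcs W = A" "tail W = fst" "head W = f"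
    by (simp_all add: W_def)
  have f: "f e \<in> carrier G" if "e \<in> A" for e
    using D that by (auto simp: D_digraph_def A_def)
  interpret W: fin_digraph W
    by unfold_locales (use f fin in \<open>auto simp: W A_def\<close>)
  interpret S: pair_wf_digraph "mk_symmetric W" ..
  have "connected W"
  proof (rule W.connectedI)
    show "verts W \<noteq> {}" by (auto simp: W)
    fix u v assume uv: "u \<in> verts W" "v \<in> verts W"
    let ?P = "\<lambda>x. u \<rightarrow>\<^sup>*\<^bsub>mk_symmetric W\<^esub> x"
    have "?P (fst e) \<longleftrightarrow> ?P (f e)" if "e \<in> A" for e
    proof -
      have "(fst e, f e) \<in> parcs (mk_symmetric W)" "(f e, fst e) \<in> parcs (mk_symmetric W)"
        using that by (force simp: parcs_mk_symmetric W)+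
      then show ?thesis
        using S.reachable_adj_trans[of u] by (metis with_proj_simps(3))
    qed
    moreover have "?P u" using uv by (auto simp: W intro!: S.reachable_refl)
    ultimately show "?P v"
      using D uv unfolding D_digraph_def A_def W by blast
  qed
  moreover have "in_degree W u = out_degree W u" if "u \<in> verts W" for u
  proof -
    have "{e \<in> A. fst e = u} = {(u, False), (u, True)}"
      using that by (auto simp: W A_def)
    then have "out_degree W u = 2"
      by (simp add: out_degree_def out_arcs_def W)
    moreover have "in_degree W u = 2"
      using that D by (simp add: in_degree_def in_arcs_def W D_digraph_def A_def)
    ultimately show ?thesis by simp
  qed
  ultimately obtain u p where p: "W.euler_trail u p u"
    using W.closed_euler1 by blast
  then have cas: "W.cas u p u" and dist: "distinct p" and set: "set p = A"
    by (auto simp: W.euler_trail_def W.trail_def W.awalk_def W)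
  have ne: "p \<noteq> []" using set one_closed by (force simp: A_def)
  show thesis
  proof (rule that)
    fix i assume i: "i < length p"
    show "f (p ! i) = fst (p ! (Suc i mod length p))"
    proof (cases "Suc i < length p")
      case True
      then show ?thesis using W.cas_nth[OF cas True] by (simp add: W)
    next
      case False
      then have "i = length p - 1" "Suc i = length p" using i by auto
      then show ?thesis
        using W.cas_hd_last[OF cas ne] ne by (simp add: W last_conv_nth hd_conv_nth)
    qed
  qed (use dist set in \<open>simp_all add: A_def\<close>)
qed

lemma (in group) D_sequenceable_if_D_digraph:
  assumes fin: "finite (carrier G)" and D: "D_digraph G f"
  shows "D_sequenceable G"
proof -
  define A where "A = carrier G \<times> (UNIV :: bool set)"
  define n where "n = 2 * order G"
  obtain p where dist: "distinct p" and set: "set p = A"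
    and next_arc: "\<And>i. i < length p \<Longrightarrow> f (p ! i) = fst (p ! (Suc i mod length p))"
    using D_digraph_euler_tour[OF D fin] unfolding A_def by metis
  have len: "length p = n"
    using distinct_card[OF dist] by (simp add: set A_def n_def order_def card_cartesian_product)
  have n0: "n > 0" using fin by (auto simp: n_def order_gt_0_iff_finite)
  have f: "f e \<in> carrier G" if "e \<in> A" for e
    using D that by (auto simp: D_digraph_def A_def)
  have "card {e \<in> A. inv (fst e) \<otimes> f e = \<one>} = 2"
    using D by (simp add: D_digraph_def A_def)
  then have "{e \<in> A. inv (fst e) \<otimes> f e = \<one>} \<noteq> {}" by (metis card.empty zero_neq_numeral)
  then obtain e where e: "e \<in> A" "inv (fst e) \<otimes> f e = \<one>" by blast
  then obtain j where j: "j < n" "p ! j = e"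
    using set len by (metis in_set_conv_nth)
  \<comment> \<open>Start the tour with the loop, and read off the heads of its arcs: then the quotient
    at every index, including the conventional one at 0, is the step of the arc there.\<close>
  define r where "r i = p ! ((j + i) mod n)" for i
  have rA: "r i \<in> A" for i using set len n0 by (metis r_def mod_less_divisor nth_mem)
  have r_next: "f (r i) = fst (r (Suc i))" for i
    using next_arc[of "(j + i) mod n"] n0 by (simp add: r_def len mod_Suc_eq)
  have r0: "r 0 = e" using j by (simp add: r_def)
  have bij: "bij_betw r {..<n} A"
  proof -
    have "inj_on r {..<n}"
    proof (rule inj_onI)
      fix a b assume ab: "a \<in> {..<n}" "b \<in> {..<n}" "r a = r b"
      then have "(j + a) mod n = (j + b) mod n"
        using dist len n0 by (simp add: r_def nth_eq_iff_index_eq)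
      then have "a mod n = b mod n" by (simp add: mod_eq_nat1E nat_mod_eq_iff)
      then show "a = b" using ab by simp
    qed
    moreover have "card A = n" using distinct_card[OF dist] set len by simp
    moreover have "r ` {..<n} \<subseteq> A" using rA by auto
    ultimately show ?thesis
      by (metis bij_betw_def card_image card_lessThan card_subset_eq finite_set set)
  qed
  have count: "card {i. i < n \<and> Q (r i)} = card {e \<in> A. Q e}" for Q
  proof -
    have "bij_betw r {i. i < n \<and> Q (r i)} {e \<in> A. Q e}"
      using bij by (auto simp: bij_betw_def inj_on_def)
    then show ?thesis by (rule bij_betw_same_card)
  qed
  define u where "u = fst e"
  have u: "u \<in> carrier G" using e by (auto simp: u_def A_def)
  have tail: "fst (r i) \<in> carrier G" for i using rA[of i] by (auto simp: A_def)
  have head: "f (r i) \<in> carrier G" for i using rA f by blast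
  have head0: "f (r 0) = u"
    using e u f[OF e(1)] inv_solve_left[of \<one> u "f e"] by (simp add: r0 u_def)
  define g where "g i = inv u \<otimes> f (r i)" for i
  have quot: "quotient_seq G g i = inv (fst (r i)) \<otimes> f (r i)" for i
  proof (cases i)
    case 0
    then show ?thesis using e by (simp add: quotient_seq_def r0)
  next
    case (Suc k)
    have "quotient_seq G g i = inv (inv u \<otimes> fst (r i)) \<otimes> (inv u \<otimes> f (r i))"
      by (simp add: quotient_seq_def g_def r_next Suc)
    also have "\<dots> = inv (fst (r i)) \<otimes> (u \<otimes> (inv u \<otimes> f (r i)))"
      using u tail[of i] head[of i] by (simp add: inv_mult_group m_assoc)
    also have "u \<otimes> (inv u \<otimes> f (r i)) = f (r i)"
      using u head[of i] by (simp add: m_assoc[symmetric])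
    finally show ?thesis .
  qed
  show ?thesis
    unfolding D_sequenceable_def n_def[symmetric]
  proof (intro exI conjI ballI allI impI)
    show "g i \<in> carrier G" for i using u head by (simp add: g_def)
    show "g 0 = \<one>" using u head0 by (simp add: g_def)
  next
    fix x assume x: "x \<in> carrier G"
    have "g i = x \<longleftrightarrow> f (r i) = u \<otimes> x" for i
      using u head[of i] x inv_solve_left by (auto simp: g_def)
    then have "card {i. i < n \<and> g i = x} = card {e \<in> A. f e = u \<otimes> x}"
      using count[of "\<lambda>e. f e = u \<otimes> x"] by simp
    then show "card {i. i < n \<and> g i = x} = 2"
      using D u x by (simp add: D_digraph_def A_def)
  next
    fix x assume x: "x \<in> carrier G"
    show "card {i. i < n \<and> quotient_seq G g i = x} = 2"
      using count[of "\<lambda>e. inv (fst e) \<otimes> f e = x"] D x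
      by (simp add: quot D_digraph_def A_def)
  qed
qed

section \<open>Lifting a digraph from a quotient\<close>

text \<open>
  A permutation \<open>t\<close> of \<open>H\<close> for which \<open>h \<mapsto> h\<inverse> t h\<close> is a permutation as well is an orthomorphism of
  \<open>H\<close>. The last clause says that \<open>H\<close> is a single orbit under
  \<open>t\<close> and multiplication by \<open>c\<close>.
\<close>

definition linking_orthomorphism ::
    "('a, 'b) monoid_scheme \<Rightarrow> 'a set \<Rightarrow> ('a \<Rightarrow> 'a) \<Rightarrow> 'a \<Rightarrow> bool" where
  "linking_orthomorphism G H t c \<longleftrightarrow>
     bij_betw t H H \<and> bij_betw (\<lambda>h. inv\<^bsub>G\<^esub> h \<otimes>\<^bsub>G\<^esub> t h) H H \<and> c \<in> H \<and>
     (\<forall>P. (\<forall>h\<in>H. P h \<longleftrightarrow> P (t h)) \<longrightarrow> (\<forall>h\<in>H. P h \<longleftrightarrow> P (h \<otimes>\<^bsub>G\<^esub> c)) \<longrightarrow>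
          (\<forall>h\<in>H. \<forall>k\<in>H. P h \<longrightarrow> P k))"

text \<open>
  The counting behind the lift, used once for heads and once for steps: if \<open>F\<close> maps each fibre of
  \<open>p\<close> bijectively onto a fibre of \<open>q\<close>, then a value of \<open>F\<close> is attained exactly once over each place
  where the induced map \<open>F0\<close> attains the value below it.
\<close>

lemma card_preimage_via_fibres:
  assumes p: "p ` A' \<subseteq> A"
    and F: "\<And>e. e \<in> A \<Longrightarrow> bij_betw F {a \<in> A'. p a = e} {y \<in> Y. q y = F0 e}"
    and y: "y \<in> Y"
  shows "card {a \<in> A'. F a = y} = card {e \<in> A. F0 e = q y}"
proof (rule bij_betw_same_card)
  show "bij_betw p {a \<in> A'. F a = y} {e \<in> A. F0 e = q y}"
  proof (rule bij_betw_imageI)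
    show "inj_on p {a \<in> A'. F a = y}"
    proof (rule inj_onI)
      fix a a' assume "a \<in> {a \<in> A'. F a = y}" "a' \<in> {a \<in> A'. F a = y}" "p a = p a'"
      then show "a = a'"
        using F[of "p a"] p by (auto simp: bij_betw_def inj_on_def)
    qed
    show "p ` {a \<in> A'. F a = y} = {e \<in> A. F0 e = q y}"
    proof (intro equalityI subsetI)
      fix e assume "e \<in> p ` {a \<in> A'. F a = y}"
      then obtain a where a: "a \<in> A'" "F a = y" "e = p a" by blast
      moreover have "F a \<in> {y \<in> Y. q y = F0 e}"
        using a p by (intro bij_betwE[OF F, rule_format]) auto
      ultimately show "e \<in> {e \<in> A. F0 e = q y}" using p by auto
    next
      fix e assume "e \<in> {e \<in> A. F0 e = q y}"
      then have "y \<in> F ` {a \<in> A'. p a = e}" using F[of e] y by (auto simp: bij_betw_def)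
      then show "e \<in> p ` {a \<in> A'. F a = y}" by auto
    qed
  qed
qed

lemma (in group_hom) bij_betw_kernel_fibre:
  assumes "y \<in> carrier G"
  shows "bij_betw (\<lambda>k. y \<otimes> k) (kernel G H h) {x \<in> carrier G. h x = h y}"
proof (rule bij_betw_byWitness[where f' = "\<lambda>x. inv y \<otimes> x"])
  show "\<forall>k\<in>kernel G H h. inv y \<otimes> (y \<otimes> k) = k"
    using assms by (simp add: kernel_def G.m_assoc[symmetric])
  show "\<forall>x\<in>{x \<in> carrier G. h x = h y}. y \<otimes> (inv y \<otimes> x) = x"
    using assms by (simp add: G.m_assoc[symmetric])
  show "(\<lambda>k. y \<otimes> k) ` kernel G H h \<subseteq> {x \<in> carrier G. h x = h y}"
    using assms by (auto simp: kernel_def)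
  show "(\<lambda>x. inv y \<otimes> x) ` {x \<in> carrier G. h x = h y} \<subseteq> kernel G H h"
    using assms by (auto simp: kernel_def)
qed

text \<open>
  With a section \<open>s\<close> of \<open>q\<close>, every element of \<open>G\<close> has coordinates \<open>s X \<otimes> h\<close> with \<open>h\<close> in the kernel,
  and an arc from \<open>X\<close> to \<open>Y\<close> lifts to the arcs from \<open>s X \<otimes> h\<close> to \<open>s Y \<otimes> t h\<close>, with an extra factor
  \<open>c\<close> over one of the loops. Since \<open>G\<close> is abelian, the lifted step is a constant times \<open>h\<inverse> t h\<close>,
  hence runs through a whole coset.

  For connectedness, consider a property that is constant along arcs. The untwisted loop shows that
  over its vertex it does not distinguish \<open>h\<close> from \<open>t h\<close>, and going along arcs and back carries this
  to every vertex. Hence it depends on \<open>h\<close> only, not on \<open>X\<close>. The twisted loop now shows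
  that it does not distinguish \<open>h\<close> from \<open>h \<otimes> c\<close>, so it is constant.
\<close>

lemma (in comm_group) D_digraph_lift:
  assumes "group Q" and hom: "q \<in> hom G Q" and surj: "q ` carrier G = carrier Q"
    and t: "linking_orthomorphism G (kernel G Q q) t c"
    and D: "D_digraph Q f"
  shows "\<exists>f'. D_digraph G f'"
proof -
  interpret Q: group Q by fact
  interpret q: group_hom G Q q by unfold_locales (rule hom)
  define K where "K = kernel G Q q"
  define A where "A = carrier Q \<times> (UNIV :: bool set)"
  define A' where "A' = carrier G \<times> (UNIV :: bool set)"
  have f: "f e \<in> carrier Q" if "e \<in> A" for e
    using D that by (auto simp: D_digraph_def A_def)
  have K: "k \<in> carrier G" "q k = \<one>\<^bsub>Q\<^esub>" if "k \<in> K" for k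
    using that by (auto simp: K_def kernel_def)
  have subK: "subgroup K G" unfolding K_def by (rule q.subgroup_kernel)
  have t_bij: "bij_betw t K K" and step_bij: "bij_betw (\<lambda>h. inv h \<otimes> t h) K K" and c: "c \<in> K"
    and link: "\<And>P h k. \<lbrakk>\<forall>h\<in>K. P h \<longleftrightarrow> P (t h); \<forall>h\<in>K. P h \<longleftrightarrow> P (h \<otimes> c); h \<in> K; k \<in> K; P h\<rbrakk> \<Longrightarrow> P k"
    using t unfolding linking_orthomorphism_def K_def by blast+
  have tK: "t h \<in> K" if "h \<in> K" for h using t_bij that by (auto simp: bij_betw_def)
  have t_surj: "\<exists>h'\<in>K. h = t h'" if "h \<in> K" for h using t_bij that by (auto simp: bij_betw_def)
  have "\<forall>X\<in>carrier Q. \<exists>x\<in>carrier G. q x = X" using surj by (metis imageE)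
  then obtain s where s: "\<And>X. X \<in> carrier Q \<Longrightarrow> s X \<in> carrier G"
    and qs: "\<And>X. X \<in> carrier Q \<Longrightarrow> q (s X) = X"
    by metis
  \<comment> \<open>The identity occurs twice as a step, so the digraph on the quotient has two loops.\<close>
  have "card {e \<in> A. inv\<^bsub>Q\<^esub> (fst e) \<otimes>\<^bsub>Q\<^esub> f e = \<one>\<^bsub>Q\<^esub>} = 2"
    using D by (simp add: D_digraph_def A_def)
  then obtain l l' where l: "l \<in> A" "inv\<^bsub>Q\<^esub> (fst l) \<otimes>\<^bsub>Q\<^esub> f l = \<one>\<^bsub>Q\<^esub>"
    and l': "l' \<in> A" "inv\<^bsub>Q\<^esub> (fst l') \<otimes>\<^bsub>Q\<^esub> f l' = \<one>\<^bsub>Q\<^esub>" and ll': "l \<noteq> l'"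
    unfolding card_2_iff by blast
  have loop: "f e = fst e" if "e \<in> A" "inv\<^bsub>Q\<^esub> (fst e) \<otimes>\<^bsub>Q\<^esub> f e = \<one>\<^bsub>Q\<^esub>" for e
    using that f[of e] Q.inv_solve_left[of "\<one>\<^bsub>Q\<^esub>" "fst e" "f e"] by (auto simp: A_def)
  define twist where "twist e = (if e = l' then c else \<one>)" for e
  have twist: "twist e \<in> carrier G" "q (twist e) = \<one>\<^bsub>Q\<^esub>" for e
    using c K by (auto simp: twist_def)
  define f' where
    "f' a = (let e = (q (fst a), snd a)
             in s (f e) \<otimes> t (inv (s (fst e)) \<otimes> fst a) \<otimes> twist e)" for a
  have f': "f' (s X \<otimes> h, b) = s (f (X, b)) \<otimes> t h \<otimes> twist (X, b)"
    if "X \<in> carrier Q" "h \<in> K" for X h b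
  proof -
    have "q (s X \<otimes> h) = X" using that s qs K by simp
    moreover have "inv (s X) \<otimes> (s X \<otimes> h) = h" using that s K by (simp add: m_assoc[symmetric])
    ultimately show ?thesis by (simp add: f'_def Let_def)
  qed
  have coord: "\<exists>h\<in>K. z = s (q z) \<otimes> h" if "z \<in> carrier G" for z
  proof -
    have qz: "q z \<in> carrier Q" using that by simp
    have "z \<in> {x \<in> carrier G. q x = q (s (q z))}" using that qs[OF qz] by simp
    also have "\<dots> = (\<lambda>k. s (q z) \<otimes> k) ` K"
      using q.bij_betw_kernel_fibre[OF s[OF qz]] by (simp add: bij_betw_def K_def)
    finally show ?thesis by blast
  qed
  define p where "p a = (q (fst a), snd a)" for a :: "'a \<times> bool"
  have p: "p ` A' \<subseteq> A" by (auto simp: p_def A_def A'_def)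
  have lift: "bij_betw (\<lambda>h. (s X \<otimes> h, b)) K {a \<in> A'. p a = (X, b)}"
    if X: "X \<in> carrier Q" for X b
  proof -
    have "bij_betw (\<lambda>x. (x, b)) {x \<in> carrier G. q x = q (s X)} {a \<in> A'. p a = (X, b)}"
      using X qs by (auto simp: bij_betw_def inj_on_def p_def A'_def)
    from bij_betw_trans[OF q.bij_betw_kernel_fibre[OF s[OF X]] this]
    show ?thesis by (simp add: K_def comp_def)
  qed
  have fibre: "bij_betw F {a \<in> A'. p a = (X, b)} {y \<in> carrier G. q y = q y0}"
    if X: "X \<in> carrier Q" and y0: "y0 \<in> carrier G" and g: "bij_betw g K K"
      and F: "\<And>h. h \<in> K \<Longrightarrow> F (s X \<otimes> h, b) = y0 \<otimes> g h" for F X b y0 g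
  proof -
    have "bij_betw (\<lambda>h. y0 \<otimes> g h) K {y \<in> carrier G. q y = q y0}"
      using bij_betw_trans[OF g[unfolded K_def] q.bij_betw_kernel_fibre[OF y0]]
      by (simp add: K_def comp_def)
    then have "bij_betw (F \<circ> (\<lambda>h. (s X \<otimes> h, b))) K {y \<in> carrier G. q y = q y0}"
      using F by (subst bij_betw_cong[where g = "\<lambda>h. y0 \<otimes> g h"]) auto
    then show ?thesis
      using bij_betw_comp_iff[OF lift[OF X]] by blast
  qed
  have "D_digraph G f'"
    unfolding D_digraph_def A'_def[symmetric]
  proof (intro conjI ballI allI impI)
    have "f' a \<in> carrier G" if "a \<in> A'" for a
    proof -
      obtain x b where a: "a = (x, b)" "x \<in> carrier G" using \<open>a \<in> A'\<close> by (auto simp: A'_def)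
      obtain h where h: "h \<in> K" "x = s (q x) \<otimes> h" using coord a by blast
      have qx: "q x \<in> carrier Q" "(q x, b) \<in> A" using a by (auto simp: A_def)
      then have "f' (s (q x) \<otimes> h, b) \<in> carrier G"
        using f'[OF _ h(1)] s[OF f] K(1)[OF tK[OF h(1)]] twist by simp
      then show ?thesis using a h by simp
    qed
    then show "f' \<in> A' \<rightarrow> carrier G" by blast
  next
    fix y assume y: "y \<in> carrier G"
    have "bij_betw f' {a \<in> A'. p a = e} {y \<in> carrier G. q y = f e}" if "e \<in> A" for e
    proof -
      obtain X b where e: "e = (X, b)" "X \<in> carrier Q" using \<open>e \<in> A\<close> by (auto simp: A_def)
      have "q (s (f e) \<otimes> twist e) = f e" using s qs f[OF that] twist by simp
      moreover have "f' (s X \<otimes> h, b) = (s (f e) \<otimes> twist e) \<otimes> t h" if "h \<in> K" for h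
        using f'[OF e(2) that] s[OF f[OF \<open>e \<in> A\<close>]] tK[OF that] K(1) twist(1)[of e]
        by (simp add: e(1) m_ac)
      ultimately show ?thesis
        using fibre[OF e(2) _ t_bij, of "s (f e) \<otimes> twist e" f' b] s[OF f[OF that]] twist
        by (simp add: e(1))
    qed
    from card_preimage_via_fibres[OF p this y]
    have "card {a \<in> A'. f' a = y} = card {e \<in> A. f e = q y}" .
    then show "card {a \<in> A'. f' a = y} = 2"
      using D y by (simp add: D_digraph_def A_def)
  next
    fix d assume d: "d \<in> carrier G"
    have "bij_betw (\<lambda>a. inv (fst a) \<otimes> f' a) {a \<in> A'. p a = e}
            {y \<in> carrier G. q y = inv\<^bsub>Q\<^esub> (fst e) \<otimes>\<^bsub>Q\<^esub> f e}" if "e \<in> A" for e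
    proof -
      obtain X b where e: "e = (X, b)" "X \<in> carrier Q" using \<open>e \<in> A\<close> by (auto simp: A_def)
      define y0 where "y0 = inv (s X) \<otimes> s (f e) \<otimes> twist e"
      have y0: "y0 \<in> carrier G" "q y0 = inv\<^bsub>Q\<^esub> (fst e) \<otimes>\<^bsub>Q\<^esub> f e"
        using s qs f[OF that] twist e by (simp_all add: y0_def)
      have "inv (fst (s X \<otimes> h, b)) \<otimes> f' (s X \<otimes> h, b) = y0 \<otimes> (inv h \<otimes> t h)" if "h \<in> K" for h
        using f'[OF e(2) that] s[OF f[OF \<open>e \<in> A\<close>]] s[OF e(2)] tK[OF that] K(1) twist(1)[of e] that
        by (simp add: e(1) m_ac y0_def inv_mult)
      then show ?thesis
        using fibre[OF e(2) y0(1) step_bij, of "\<lambda>a. inv (fst a) \<otimes> f' a" b] y0(2)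
        by (simp add: e(1))
    qed
    from card_preimage_via_fibres[OF p this d]
    have "card {a \<in> A'. inv (fst a) \<otimes> f' a = d}
        = card {e \<in> A. inv\<^bsub>Q\<^esub> (fst e) \<otimes>\<^bsub>Q\<^esub> f e = q d}" .
    then show "card {a \<in> A'. inv (fst a) \<otimes> f' a = d} = 2"
      using D d by (simp add: D_digraph_def A_def)
  next
    fix P x y
    assume P: "\<forall>a\<in>A'. P (fst a) \<longleftrightarrow> P (f' a)"
      and x: "x \<in> carrier G" and y: "y \<in> carrier G" and Px: "P x"
    have D_conn: "R Y" if "\<And>e. e \<in> A \<Longrightarrow> R (fst e) \<longleftrightarrow> R (f e)" "R X" "X \<in> carrier Q" "Y \<in> carrier Q"
      for R X Y
      using D that unfolding D_digraph_def A_def by blast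
    have arc: "P (s X \<otimes> h) \<longleftrightarrow> P (s (f (X, b)) \<otimes> t h \<otimes> twist (X, b))"
      if "X \<in> carrier Q" "h \<in> K" for X h b
      using P[rule_format, of "(s X \<otimes> h, b)"] f'[OF that] s[OF that(1)] K[OF that(2)]
      by (simp add: A'_def)
    have plain_arc: "P (s (fst e) \<otimes> h) \<longleftrightarrow> P (s (f e) \<otimes> t h)"
      if "e \<in> A" "e \<noteq> l'" "h \<in> K" for e h
      using arc[of "fst e" h "snd e"] that s[OF f[OF that(1)]] K(1)[OF tK[OF that(3)]]
      by (auto simp: A_def twist_def)
    \<comment> \<open>The untwisted loop gives this at its own vertex; surjectivity of \<open>t\<close> lets it travel along
      an arc in either direction.\<close>
    have t_inv: "\<forall>h\<in>K. P (s X \<otimes> h) \<longleftrightarrow> P (s X \<otimes> t h)" if "X \<in> carrier Q" for X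
    proof (rule D_conn[where X = "fst l"])
      show "\<forall>h\<in>K. P (s (fst l) \<otimes> h) \<longleftrightarrow> P (s (fst l) \<otimes> t h)"
        using plain_arc[OF l(1) ll'] loop[OF l] by simp
      show "fst l \<in> carrier Q" using l by (auto simp: A_def)
      show "(\<forall>h\<in>K. P (s (fst e) \<otimes> h) \<longleftrightarrow> P (s (fst e) \<otimes> t h)) \<longleftrightarrow>
            (\<forall>h\<in>K. P (s (f e) \<otimes> h) \<longleftrightarrow> P (s (f e) \<otimes> t h))" if "e \<in> A" for e
      proof (cases "e = l'")
        case True
        then show ?thesis using loop[OF l'] by simp
      next
        case False
        show ?thesis
          using plain_arc[OF that False] tK t_surj by metis
      qed
    qed (rule that)
    have section_inv: "\<forall>h\<in>K. P (s X \<otimes> h) \<longleftrightarrow> P (s Y \<otimes> h)"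
      if "X \<in> carrier Q" "Y \<in> carrier Q" for X Y
    proof (rule D_conn[where X = X])
      show "(\<forall>h\<in>K. P (s X \<otimes> h) \<longleftrightarrow> P (s (fst e) \<otimes> h)) \<longleftrightarrow>
            (\<forall>h\<in>K. P (s X \<otimes> h) \<longleftrightarrow> P (s (f e) \<otimes> h))" if "e \<in> A" for e
      proof (cases "e = l'")
        case True
        then show ?thesis using loop[OF l'] by simp
      next
        case False
        have "\<forall>h\<in>K. P (s (fst e) \<otimes> h) \<longleftrightarrow> P (s (f e) \<otimes> h)"
          using plain_arc[OF that False] t_inv[OF f[OF that]] by blast
        then show ?thesis by blast
      qed
    qed (use that in auto)
    let ?W = "fst l'"
    have W: "?W \<in> carrier Q" using l' by (auto simp: A_def)
    have twist_inv: "P (s ?W \<otimes> h) \<longleftrightarrow> P (s ?W \<otimes> (h \<otimes> c))" if "h \<in> K" for h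
    proof -
      obtain h' where h': "h' \<in> K" "h = t h'" using t_surj \<open>h \<in> K\<close> by blast
      have "P (s ?W \<otimes> h') \<longleftrightarrow> P (s ?W \<otimes> t h' \<otimes> c)"
        using arc[OF W h'(1), of "snd l'"] loop[OF l'] by (simp add: twist_def)
      then show ?thesis
        using t_inv[OF W] h' s[OF W] K(1) c that by (simp add: m_assoc)
    qed
    obtain h k where h: "h \<in> K" "x = s (q x) \<otimes> h" and k: "k \<in> K" "y = s (q y) \<otimes> k"
      using coord x y by metis
    have "P (s ?W \<otimes> h)"
      using section_inv[of "q x" ?W] x W h Px by fastforce
    then have "P (s ?W \<otimes> k)"
      using link[of "\<lambda>h. P (s ?W \<otimes> h)" h k] t_inv[OF W] twist_inv h k by blast
    then show "P y"
      using section_inv[of ?W "q y"] y W k by fastforce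
  qed
  then show ?thesis by blast
qed

section \<open>The de Bruijn digraph of squaring\<close>

text \<open>
  The hypothesis \<open>two\<close> is the in-degree condition; the steps \<open>x\<close> and \<open>x \<otimes> c\<close> take every value twice
  in any case. Connectedness is that of de Bruijn graphs: every vertex is the head of some arc, so
  \<open>K\<close> arcs can be followed backwards from any vertex. The same choices followed forwards from another
  starting point end in the same vertex, because after \<open>K\<close> squarings the starting point has
  been raised to the power \<open>2 ^ K\<close> and is forgotten. In particular every vertex is reached from \<open>\<one>\<close>.
\<close>

lemma (in comm_group) D_digraph_squaring:
  assumes c: "c \<in> carrier G" and fin: "finite (carrier G)"
    and two: "\<And>y. y \<in> carrier G \<Longrightarrow>
      card {x \<in> carrier G. x \<otimes> x = y} + card {x \<in> carrier G. x \<otimes> x \<otimes> c = y} = 2"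
    and exponent: "\<And>x. x \<in> carrier G \<Longrightarrow> x [^] ((2::nat) ^ K) = \<one>"
  shows "D_digraph G (\<lambda>(x, b). x \<otimes> x \<otimes> (if b then c else \<one>))" (is "D_digraph G ?f")
  unfolding D_digraph_def
proof (intro conjI ballI allI impI)
  show "?f \<in> carrier G \<times> UNIV \<rightarrow> carrier G" using c by auto
next
  fix y assume y: "y \<in> carrier G"
  let ?S = "{x \<in> carrier G. x \<otimes> x = y}" and ?T = "{x \<in> carrier G. x \<otimes> x \<otimes> c = y}"
  have "{e \<in> carrier G \<times> UNIV. ?f e = y} = (\<lambda>x. (x, False)) ` ?S \<union> (\<lambda>x. (x, True)) ` ?T"
    by (auto simp: split_def image_iff split: if_splits)
  moreover have "card \<dots> = card ?S + card ?T"
    using fin by (subst card_Un_disjoint) (auto simp: card_image inj_on_def)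
  ultimately show "card {e \<in> carrier G \<times> UNIV. ?f e = y} = 2" using two[OF y] by simp
next
  fix d assume d: "d \<in> carrier G"
  have step: "inv x \<otimes> ?f (x, b) = x \<otimes> (if b then c else \<one>)" if "x \<in> carrier G" for x b
    using that c by (simp add: m_assoc[symmetric])
  have "{e \<in> carrier G \<times> UNIV. inv (fst e) \<otimes> ?f e = d} = {(d, False), (d \<otimes> inv c, True)}"
  proof (intro equalityI subsetI)
    fix e assume "e \<in> {e \<in> carrier G \<times> UNIV. inv (fst e) \<otimes> ?f e = d}"
    then obtain x b where "e = (x, b)" "x \<in> carrier G" "x \<otimes> (if b then c else \<one>) = d"
      using step by (cases e) auto
    then show "e \<in> {(d, False), (d \<otimes> inv c, True)}"
      using c d inv_solve_right'[of d c x] by (cases b) (auto simp: m_assoc)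
  next
    fix e assume "e \<in> {(d, False), (d \<otimes> inv c, True)}"
    then show "e \<in> {e \<in> carrier G \<times> UNIV. inv (fst e) \<otimes> ?f e = d}"
      using c d step[of d False] step[of "d \<otimes> inv c" True] by (auto simp: m_assoc)
  qed
  then show "card {e \<in> carrier G \<times> UNIV. inv (fst e) \<otimes> ?f e = d} = 2" by simp
next
  fix P x y
  assume P: "\<forall>e\<in>carrier G \<times> UNIV. P (fst e) \<longleftrightarrow> P (?f e)"
    and x: "x \<in> carrier G" and y: "y \<in> carrier G" and Px: "P x"
  have arc: "P z \<longleftrightarrow> P (z \<otimes> z \<otimes> e)" if "z \<in> carrier G" "e = \<one> \<or> e = c" for z e
    using P[rule_format, of "(z, e = c)"] that by auto
  have root: "\<exists>w\<in>carrier G. \<exists>e. (e = \<one> \<or> e = c) \<and> z = w \<otimes> w \<otimes> e" if "z \<in> carrier G" for z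
  proof -
    have "{x \<in> carrier G. x \<otimes> x = z} \<noteq> {} \<or> {x \<in> carrier G. x \<otimes> x \<otimes> c = z} \<noteq> {}"
      using two[OF that] by (metis card.empty add.right_neutral zero_neq_numeral)
    then show ?thesis by force
  qed
  have walk: "\<exists>w\<in>carrier G. \<exists>d\<in>carrier G. z = w [^] ((2::nat) ^ k) \<otimes> d \<and>
                (\<forall>v\<in>carrier G. P v \<longleftrightarrow> P (v [^] ((2::nat) ^ k) \<otimes> d))"
    if z: "z \<in> carrier G" for z k
  proof (induction k)
    case 0
    show ?case using z by (intro bexI[of _ z] bexI[of _ \<one>]) auto
  next
    case (Suc k)
    then obtain w d where w: "w \<in> carrier G" and d: "d \<in> carrier G"
      and zw: "z = w [^] ((2::nat) ^ k) \<otimes> d"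
      and Pw: "\<And>v. v \<in> carrier G \<Longrightarrow> P v \<longleftrightarrow> P (v [^] ((2::nat) ^ k) \<otimes> d)" by blast
    obtain u e where u: "u \<in> carrier G" and e: "e = \<one> \<or> e = c" and wu: "w = u \<otimes> u \<otimes> e"
      using root[OF w] by blast
    have eG: "e \<in> carrier G" using e c by auto
    let ?d = "e [^] ((2::nat) ^ k) \<otimes> d"
    have pow: "(v \<otimes> v \<otimes> e) [^] ((2::nat) ^ k) \<otimes> d = v [^] ((2::nat) ^ Suc k) \<otimes> ?d"
      if "v \<in> carrier G" for v
      using that eG d by (simp add: pow_mult_distrib m_comm nat_pow_mult m_assoc mult_2)
    have "P v \<longleftrightarrow> P (v [^] ((2::nat) ^ Suc k) \<otimes> ?d)" if "v \<in> carrier G" for v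
      using arc[OF that e] Pw[of "v \<otimes> v \<otimes> e"] pow[OF that] that eG by simp
    moreover have "z = u [^] ((2::nat) ^ Suc k) \<otimes> ?d" using pow[OF u] zw wu by simp
    ultimately show ?case using u eG d by (intro bexI[of _ u] bexI[of _ ?d]) auto
  qed
  have "P z \<longleftrightarrow> P \<one>" if "z \<in> carrier G" for z
  proof -
    obtain w d where "w \<in> carrier G" "d \<in> carrier G" "z = w [^] ((2::nat) ^ K) \<otimes> d"
      and Pd: "\<And>v. v \<in> carrier G \<Longrightarrow> P v \<longleftrightarrow> P (v [^] ((2::nat) ^ K) \<otimes> d)"
      using walk[OF \<open>z \<in> carrier G\<close>, of K] by blast
    then have "z = d" using exponent by simp
    then show ?thesis using Pd[of \<one>] \<open>d \<in> carrier G\<close> by simp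
  qed
  then show "P y" using x y Px by blast
qed

text \<open>
  If \<open>\<one>\<close> has only itself as a square root, squaring is a bijection. Otherwise squaring is two-to-one
  onto the subgroup of squares, which therefore has index two, and \<open>c\<close> is taken in the other coset:
  every element is then a square or \<open>c\<close> times a square, but not both.
\<close>

lemma (in comm_group) square_fibres_complementary:
  assumes fin: "finite (carrier G)"
    and unique: "\<And>a b. \<lbrakk>a \<in> carrier G; b \<in> carrier G; a \<otimes> a = \<one>; b \<otimes> b = \<one>; a \<noteq> \<one>; b \<noteq> \<one>\<rbrakk> \<Longrightarrow> a = b"
  shows "\<exists>c\<in>carrier G. \<forall>y\<in>carrier G.
      card {x \<in> carrier G. x \<otimes> x = y} + card {x \<in> carrier G. x \<otimes> x \<otimes> c = y} = 2"
proof -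
  have quot: "(x \<otimes> inv w) \<otimes> (x \<otimes> inv w) = (x \<otimes> x) \<otimes> inv (w \<otimes> w)"
    if "x \<in> carrier G" "w \<in> carrier G" for x w
    using that by (simp add: m_ac inv_mult)
  show ?thesis
  proof (cases "\<exists>t\<in>carrier G. t \<otimes> t = \<one> \<and> t \<noteq> \<one>")
    case False
    have inj: "inj_on (\<lambda>x. x \<otimes> x) (carrier G)"
    proof (rule inj_onI)
      fix x w assume xw: "x \<in> carrier G" "w \<in> carrier G" "x \<otimes> x = w \<otimes> w"
      then have "(x \<otimes> inv w) \<otimes> (x \<otimes> inv w) = \<one>" by (simp only: quot) simp
      then have "x \<otimes> inv w = \<one>" using False xw by blast
      then show "x = w" using xw inv_solve_right'[of \<one> x w] by simp
    qed
    have surj: "(\<lambda>x. x \<otimes> x) ` carrier G = carrier G"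
      by (rule endo_inj_surj[OF fin _ inj]) auto
    have "card {x \<in> carrier G. x \<otimes> x = y} = 1" if "y \<in> carrier G" for y
    proof -
      obtain x where x: "x \<in> carrier G" "x \<otimes> x = y" using surj \<open>y \<in> carrier G\<close> by (metis (no_types, lifting) imageE)
      have "x' = x" if "x' \<in> carrier G" "x' \<otimes> x' = y" for x'
        using inj_onD[OF inj _ that(1) x(1)] that x by simp
      then have "{x \<in> carrier G. x \<otimes> x = y} = {x}" using x by blast
      then show ?thesis by simp
    qed
    moreover have "{x \<in> carrier G. x \<otimes> x \<otimes> \<one> = y} = {x \<in> carrier G. x \<otimes> x = y}" for y by auto
    ultimately show ?thesis by (intro bexI[of _ \<one>]) auto
  next
    case True
    then obtain t where t: "t \<in> carrier G" "t \<otimes> t = \<one>" "t \<noteq> \<one>" by blast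
    define S where "S = (\<lambda>x. x \<otimes> x) ` carrier G"
    have SG: "S \<subseteq> carrier G" by (auto simp: S_def)
    then have finS: "finite S" using fin finite_subset by blast
    have fibre: "card {x \<in> carrier G. x \<otimes> x = y} = (if y \<in> S then 2 else 0)" for y
    proof (cases "y \<in> S")
      case True
      then obtain w where w: "w \<in> carrier G" "y = w \<otimes> w" by (auto simp: S_def)
      have "x = w \<or> x = w \<otimes> t" if x: "x \<in> carrier G" "x \<otimes> x = w \<otimes> w" for x
      proof -
        have "(x \<otimes> inv w) \<otimes> (x \<otimes> inv w) = \<one>"
          using x(2) w(1) by (simp only: quot[OF x(1) w(1)]) simp
        then have "x \<otimes> inv w = \<one> \<or> x \<otimes> inv w = t"
          using unique[OF _ t(1) _ t(2) _ t(3), of "x \<otimes> inv w"] x(1) w(1) by blast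
        then show ?thesis
          using x w t inv_solve_right'[of _ x w] by (auto simp: m_comm)
      qed
      moreover have "(w \<otimes> t) \<otimes> (w \<otimes> t) = w \<otimes> w"
      proof -
        have "(w \<otimes> t) \<otimes> (w \<otimes> t) = (w \<otimes> w) \<otimes> (t \<otimes> t)" using w(1) t(1) by (simp add: m_ac)
        then show ?thesis using w t by simp
      qed
      ultimately have "{x \<in> carrier G. x \<otimes> x = y} = {w, w \<otimes> t}"
        using w t by auto
      moreover have "w \<noteq> w \<otimes> t" using w t by (metis l_cancel_one')
      ultimately show ?thesis using True by simp
    next
      case False
      then have "{x \<in> carrier G. x \<otimes> x = y} = {}" by (auto simp: S_def)
      then show ?thesis using False by (simp only: card.empty if_False)
    qed
    have "card (carrier G) = (\<Sum>y\<in>S. card {x \<in> carrier G. x \<otimes> x = y})"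
      using sum.image_gen[OF fin, of "\<lambda>_. 1::nat" "\<lambda>x. x \<otimes> x"] by (simp add: S_def)
    then have index: "card (carrier G) = 2 * card S" by (simp add: fibre)
    then have "S \<noteq> carrier G" using fin by (metis card_0_eq carrier_not_empty mult_2 add_eq_self_zero)
    then obtain c where c: "c \<in> carrier G" "c \<notin> S" using SG by blast
    define T where "T = (\<lambda>x. x \<otimes> c) ` S"
    have TG: "T \<subseteq> carrier G" using SG c by (auto simp: T_def)
    have T: "y \<in> T \<longleftrightarrow> y \<otimes> inv c \<in> S" if "y \<in> carrier G" for y
    proof
      assume "y \<in> T"
      then obtain x where "x \<in> S" "y = x \<otimes> c" by (auto simp: T_def)
      then show "y \<otimes> inv c \<in> S" using SG c by (auto simp: m_assoc)
    next
      assume "y \<otimes> inv c \<in> S"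
      moreover have "y = (y \<otimes> inv c) \<otimes> c" using that c by (simp add: m_assoc)
      ultimately show "y \<in> T" unfolding T_def by blast
    qed
    have "inj_on (\<lambda>x. x \<otimes> c) S" using SG c by (meson inj_onI right_cancel subsetD)
    then have cardT: "card T = card S" by (simp add: T_def card_image)
    have disj: "S \<inter> T = {}"
    proof -
      have False if "x \<in> carrier G" "w \<in> carrier G" "x \<otimes> x = w \<otimes> w \<otimes> c" for x w
      proof -
        have "c = (x \<otimes> x) \<otimes> inv (w \<otimes> w)"
          using that c by (metis inv_solve_right' m_closed m_comm)
        then have "c = (x \<otimes> inv w) \<otimes> (x \<otimes> inv w)" using quot that by simp
        then show False using c that by (auto simp: S_def)
      qed
      then show ?thesis by (auto simp: S_def T_def)
    qed
    have cover: "S \<union> T = carrier G"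
    proof (rule card_subset_eq[OF fin])
      show "S \<union> T \<subseteq> carrier G" using SG TG by blast
      show "card (S \<union> T) = card (carrier G)"
        using finS disj cardT index by (subst card_Un_disjoint) (auto simp: T_def)
    qed
    show ?thesis
    proof (intro bexI[of _ c] ballI)
      fix y assume y: "y \<in> carrier G"
      have "{x \<in> carrier G. x \<otimes> x \<otimes> c = y} = {x \<in> carrier G. x \<otimes> x = y \<otimes> inv c}"
        using c y inv_solve_right by auto
      then show "card {x \<in> carrier G. x \<otimes> x = y} + card {x \<in> carrier G. x \<otimes> x \<otimes> c = y} = 2"
        using fibre T[OF y] y disj cover by auto
    qed (rule c)
  qed
qed

section \<open>Subgroups with a linking orthomorphism\<close>

text \<open>
  Here \<open>h\<inverse> t h\<close> is \<open>h\<inverse> h\<inverse>\<close>, and in odd order \<open>2 * m + 1\<close> squaring is undone by the power \<open>m + 1\<close>.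
  Translation by the generator \<open>x\<close> alone already links the whole subgroup.
\<close>

lemma (in comm_group) linking_orthomorphism_inv:
  assumes fin: "finite (carrier G)" and x: "x \<in> carrier G" and ord: "odd (ord x)"
  shows "linking_orthomorphism G (generate G {x}) (\<lambda>h. inv h) x"
proof -
  define H where "H = generate G {x}"
  interpret H: subgroup H G unfolding H_def using x by (intro generate_is_subgroup) auto
  have powers: "H = {x [^] k | k. k \<in> (UNIV :: nat set)}"
    unfolding H_def by (rule generate_pow_on_finite_carrier[OF fin x])
  have xH: "x \<in> H" unfolding H_def by (rule generate.incl) simp
  have finH: "finite H" using fin H.subset finite_subset by blast
  obtain m where m: "ord x = 2 * m + 1" using ord by (rule oddE)
  have sqrt: "(h \<otimes> h) [^] (m + 1) = h" if "h \<in> H" for h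
  proof -
    obtain k :: nat where k: "h = x [^] k" using powers \<open>h \<in> H\<close> by blast
    have h: "h \<in> carrier G" using that by (rule H.mem_carrier)
    have "h [^] ord x = \<one>"
      using x by (simp add: k nat_pow_pow pow_eq_id)
    moreover have "(h \<otimes> h) [^] (m + 1) = h [^] (ord x + 1)"
    proof -
      have "(h \<otimes> h) [^] (m + 1) = h [^] ((m + 1) + (m + 1))"
        using pow_mult_distrib[of h h "m + 1"] nat_pow_mult[OF h, of "m + 1" "m + 1"] h by simp
      then show ?thesis by (simp only: m) (simp add: mult_2)
    qed
    ultimately show ?thesis using h by simp
  qed
  have inv_bij: "bij_betw (\<lambda>h. inv h) H H"
    by (rule bij_betw_byWitness[where f' = "\<lambda>h. inv h"]) auto
  have "inj_on (\<lambda>h. inv h \<otimes> inv h) H"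
  proof (rule inj_onI)
    fix h k assume hk: "h \<in> H" "k \<in> H" "inv h \<otimes> inv h = inv k \<otimes> inv k"
    then have "inv h = inv k" using sqrt[of "inv h"] sqrt[of "inv k"] by simp
    then show "h = k" using hk(1,2) by (metis H.mem_carrier inv_inv)
  qed
  then have step_bij: "bij_betw (\<lambda>h. inv h \<otimes> inv h) H H"
    using endo_inj_surj[OF finH, of "\<lambda>h. inv h \<otimes> inv h"]
    by (simp add: bij_betw_def image_subset_iff)
  have to_one: "P h \<longleftrightarrow> P \<one>" if P: "\<forall>h\<in>H. P h \<longleftrightarrow> P (h \<otimes> x)" and h: "h \<in> H" for P h
  proof -
    have "P (x [^] k) \<longleftrightarrow> P \<one>" for k :: nat
    proof (induction k)
      case (Suc k)
      have "x [^] k \<in> H" using powers by blast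
      then have "P (x [^] k) \<longleftrightarrow> P (x [^] k \<otimes> x)" using P by blast
      then show ?case using Suc by simp
    qed simp
    then show ?thesis using h powers by blast
  qed
  show ?thesis
    unfolding linking_orthomorphism_def H_def[symmetric]
  proof (intro conjI allI impI ballI)
    fix P h k
    assume "\<forall>h\<in>H. P h \<longleftrightarrow> P (h \<otimes> x)" "h \<in> H" "k \<in> H" "P h"
    then show "P k" using to_one[of P h] to_one[of P k] by simp
  qed (fact inv_bij step_bij xH)+
qed

lemma (in comm_group) Klein_four:
  assumes a: "a \<in> carrier G" "a \<otimes> a = \<one>" "a \<noteq> \<one>"
    and b: "b \<in> carrier G" "b \<otimes> b = \<one>" "b \<noteq> \<one>" and ab: "a \<noteq> b"
  defines "V \<equiv> {\<one>, a, b, a \<otimes> b}"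
  shows subgroup_Klein_four: "subgroup V G"
    and linking_orthomorphism_Klein_four: "\<exists>t. linking_orthomorphism G V t a"
proof -
  have aa: "a \<otimes> (a \<otimes> y) = y" and bb: "b \<otimes> (b \<otimes> y) = y" if "y \<in> carrier G" for y
    using a b that by (simp_all add: m_assoc[symmetric])
  have ba: "b \<otimes> a = a \<otimes> b" "b \<otimes> (a \<otimes> b) = a"
    using a b bb[of a] by (simp_all add: m_ac)
  have "a \<otimes> b \<noteq> a" using a b by simp
  moreover have "a \<otimes> b \<noteq> b" using a b by simp
  moreover have "a \<otimes> b \<noteq> \<one>" using a b ab aa[of b] by (metis r_one)
  ultimately have distinct: "a \<otimes> b \<noteq> a" "a \<otimes> b \<noteq> b" "a \<otimes> b \<noteq> \<one>" by auto
  have mult: "u \<otimes> v \<in> V" and self: "v \<otimes> v = \<one>" if "u \<in> V" "v \<in> V" for u v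
    using that a b aa bb ba by (auto simp: V_def m_assoc)
  have V: "V \<subseteq> carrier G" using a b by (auto simp: V_def)
  have inv: "inv v = v" if "v \<in> V" for v
    using self[OF that that] that V by (intro inv_equality) auto
  show "subgroup V G"
    using V mult inv by (intro subgroupI) (auto simp: V_def)
  \<comment> \<open>Identify \<open>V\<close> with the additive group of the field with four elements: \<open>t\<close> is multiplication by
    a generator \<open>w\<close> of the multiplicative group, and \<open>v \<mapsto> v\<inverse> t v\<close> is multiplication by \<open>w - 1\<close>,
    which is nonzero. Translation by \<open>a\<close> links the zero to the 3-cycle.\<close>
  define t where "t v = (if v = \<one> then \<one> else if v = a then b else if v = b then a \<otimes> b else a)" for v
  have t: "t \<one> = \<one>" "t a = b" "t b = a \<otimes> b" "t (a \<otimes> b) = a"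
    using a b ab distinct by (auto simp: t_def)
  have "bij_betw t V V"
    using a b ab distinct t by (auto simp: bij_betw_def inj_on_def V_def)
  moreover have "bij_betw (\<lambda>h. inv h \<otimes> t h) V V"
  proof -
    define d where "d h = inv h \<otimes> t h" for h
    have "d \<one> = \<one>" "d a = a \<otimes> b" "d b = a" "d (a \<otimes> b) = b"
      using a b inv aa ba t by (auto simp: d_def V_def m_assoc)
    then have "bij_betw d V V"
      using a b ab distinct by (auto simp: bij_betw_def inj_on_def V_def)
    then show ?thesis by (simp add: d_def[abs_def])
  qed
  moreover have "P k"
    if P: "\<forall>h\<in>V. P h \<longleftrightarrow> P (t h)" "\<forall>h\<in>V. P h \<longleftrightarrow> P (h \<otimes> a)" "h \<in> V" "k \<in> V" "P h" for P h k
  proof -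
    have mem: "\<one> \<in> V" "a \<in> V" "b \<in> V" by (auto simp: V_def)
    have "P \<one> \<longleftrightarrow> P a" using P(2)[rule_format, OF mem(1)] a by simp
    moreover have "P a \<longleftrightarrow> P b" "P b \<longleftrightarrow> P (a \<otimes> b)"
      using P(1)[rule_format, OF mem(2)] P(1)[rule_format, OF mem(3)] t by simp_all
    ultimately have "P v \<longleftrightarrow> P a" if "v \<in> V" for v
      using that unfolding V_def by blast
    then show ?thesis using P(3-5) by blast
  qed
  moreover have "a \<in> V" by (simp add: V_def)
  ultimately have "linking_orthomorphism G V t a"
    unfolding linking_orthomorphism_def by blast
  then show "\<exists>t. linking_orthomorphism G V t a" by blast
qed

section \<open>Induction on the order\<close>

text \<open>
  The factor group has cosets as elements, but an induction over groups cannot change the type of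
  their elements. So the quotient is carried over to a set of coset representatives in \<open>G\<close>.
\<close>

lemma (in comm_group) quotient_on_representatives:
  assumes fin: "finite (carrier G)" and H: "subgroup H G" "H \<noteq> {\<one>}"
  obtains Q :: "('a, 'b) monoid_scheme" and q where
    "comm_group Q" "q \<in> hom G Q" "q ` carrier G = carrier Q" "kernel G Q q = H"
    "finite (carrier Q)" "card (carrier Q) < card (carrier G)"
proof -
  interpret normal H G by (rule subgroup_imp_normal[OF H(1)])
  define r where "r x = (SOME y. y \<in> H #> x)" for x
  have r_in: "r x \<in> H #> x" if "x \<in> carrier G" for x
    unfolding r_def by (rule someI[of _ x]) (rule rcos_self[OF that H(1)])
  have r_coset: "H #> r x = H #> x" if "x \<in> carrier G" for x
    using repr_independence[OF r_in[OF that] that H(1)] by simp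
  have r_closed: "r x \<in> carrier G" if "x \<in> carrier G" for x
    using elemrcos_carrier[OF is_group that r_in[OF that]] .
  have r_eq: "r x = r y \<longleftrightarrow> H #> x = H #> y" if "x \<in> carrier G" "y \<in> carrier G" for x y
    using r_coset that by (metis r_def)
  define Q0 where "Q0 = G\<lparr>mult := \<lambda>x y. r (x \<otimes> y)\<rparr>"
  have "r (x \<otimes> y) = r (r x \<otimes> r y)" if "x \<in> carrier G" "y \<in> carrier G" for x y
    using that by (simp add: r_eq r_closed r_coset rcos_sum[symmetric])
  then have hom0: "r \<in> hom G Q0" by (intro homI) (simp_all add: Q0_def r_closed)
  define Q where "Q = Q0\<lparr>carrier := r ` carrier G, one := r \<one>\<rparr>"
  show thesis
  proof (rule that)
    show "comm_group Q" unfolding Q_def by (rule hom_imp_img_comm_group[OF hom0])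
    show "r \<in> hom G Q" using hom0 by (auto simp: hom_def Q_def Q0_def)
    show "r ` carrier G = carrier Q" by (simp add: Q_def)
    have "x \<in> H" if "x \<in> carrier G" "H #> x = H #> \<one>" for x
      using that rcos_self[OF _ H(1), of x] coset_mult_one[OF subset] by simp
    moreover have "H #> x = H #> \<one>" if "x \<in> H" for x
      using rcos_const[OF is_group that] coset_mult_one[OF subset] by simp
    ultimately show "kernel G Q r = H"
      using subset by (auto simp: kernel_def Q_def r_eq)
    show "finite (carrier Q)" using fin by (simp add: Q_def)
    obtain h where h: "h \<in> H" "h \<noteq> \<one>" using H(2) one_closed by blast
    then have "r h = r \<one>"
      using \<open>kernel G Q r = H\<close> by (auto simp: kernel_def Q_def)
    then have "\<not> inj_on r (carrier G)"
      using h subset by (auto dest: inj_onD)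
    then show "card (carrier Q) < card (carrier G)"
      using card_image_le[OF fin, of r] eq_card_imp_inj_on[OF fin, of r] by (fastforce simp: Q_def)
  qed
qed

text \<open>
  Without a nontrivial element of odd order, the largest power of two \<open>2 ^ K\<close> dividing the order of \<open>G\<close>
  annihilates \<open>G\<close>: a power \<open>x [^] 2 ^ K\<close> has odd order. This supplies the exponent that the squaring
  digraph needs, once there are no two involutions spanning a Klein four-group.
\<close>

lemma (in comm_group) D_digraph_induction_step:
  assumes fin: "finite (carrier G)"
    and IH: "\<And>Q :: ('a, 'b) monoid_scheme.
      \<lbrakk>comm_group Q; finite (carrier Q); card (carrier Q) < card (carrier G)\<rbrakk> \<Longrightarrow> \<exists>f. D_digraph Q f"
  shows "\<exists>f. D_digraph G f"
proof -
  have extend: ?thesis if H: "subgroup H G" "H \<noteq> {\<one>}" and t: "linking_orthomorphism G H t c" for H t c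
  proof -
    obtain Q :: "('a, 'b) monoid_scheme" and q where Q: "comm_group Q" "q \<in> hom G Q"
      "q ` carrier G = carrier Q" "kernel G Q q = H" "finite (carrier Q)"
      "card (carrier Q) < card (carrier G)"
      using quotient_on_representatives[OF fin H] by blast
    then obtain f where "D_digraph Q f" using IH by blast
    then show ?thesis
      using D_digraph_lift[of Q q t c f] Q t by (simp add: comm_group.axioms(2))
  qed
  show ?thesis
  proof (cases "\<exists>x\<in>carrier G. x \<noteq> \<one> \<and> odd (ord x)")
    case True
    then obtain x where x: "x \<in> carrier G" "x \<noteq> \<one>" "odd (ord x)" by blast
    have "subgroup (generate G {x}) G" using x by (intro generate_is_subgroup) auto
    moreover have "generate G {x} \<noteq> {\<one>}" using x generate.incl[of x "{x}" G] by auto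
    ultimately show ?thesis
      using extend linking_orthomorphism_inv[OF fin x(1,3)] by blast
  next
    case no_odd: False
    show ?thesis
    proof (cases "\<exists>a\<in>carrier G. \<exists>b\<in>carrier G. a \<otimes> a = \<one> \<and> b \<otimes> b = \<one> \<and> a \<noteq> \<one> \<and> b \<noteq> \<one> \<and> a \<noteq> b")
      case True
      then obtain a b where ab: "a \<in> carrier G" "a \<otimes> a = \<one>" "a \<noteq> \<one>"
          "b \<in> carrier G" "b \<otimes> b = \<one>" "b \<noteq> \<one>" "a \<noteq> b" by blast
      then show ?thesis
        using extend[OF subgroup_Klein_four[OF ab]] linking_orthomorphism_Klein_four[OF ab] by blast
    next
      case False
      then obtain c where c: "c \<in> carrier G" and two: "\<And>y. y \<in> carrier G \<Longrightarrow>
          card {x \<in> carrier G. x \<otimes> x = y} + card {x \<in> carrier G. x \<otimes> x \<otimes> c = y} = 2"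
        using square_fibres_complementary[OF fin] by blast
      have "order G \<noteq> 0" using fin by (simp add: order_gt_0_iff_finite)
      then obtain K m where Km: "order G = 2 ^ K * m" "odd m"
        by (rule multiplicity_decompose'[of "order G" 2]) auto
      have "x [^] ((2::nat) ^ K) = \<one>" if x: "x \<in> carrier G" for x
      proof -
        have "(x [^] ((2::nat) ^ K)) [^] m = \<one>"
          using x pow_order_eq_1[OF x] by (simp add: nat_pow_pow Km)
        then have "ord (x [^] ((2::nat) ^ K)) dvd m" using x by (simp add: pow_eq_id)
        then have "odd (ord (x [^] ((2::nat) ^ K)))" using Km(2) dvd_trans by blast
        then show ?thesis using no_odd x by blast
      qed
      then show ?thesis using D_digraph_squaring[OF c fin two] by blast
    qed
  qed
qed

lemma exists_D_digraph:
  fixes G :: "('a, 'b) monoid_scheme"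
  assumes "comm_group G" and "finite (carrier G)"
  shows "\<exists>f. D_digraph G f"
  using assms
proof (induction "card (carrier G)" arbitrary: G rule: less_induct)
  case less
  show ?case
    by (rule comm_group.D_digraph_induction_step[OF less.prems]) (rule less.hyps)
qed

theorem theorem8:
  fixes G :: "('a, 'b) monoid_scheme"
  assumes "comm_group G"
    and "finite (carrier G)"
  shows "D_sequenceable G"
proof -
  interpret comm_group G by fact
  show ?thesis
    using exists_D_digraph[OF assms] D_sequenceable_if_D_digraph[OF assms(2)] by blast
qed

end
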